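(* Let $f:\mathbb{R}^n\to\mathbb{R}$ be an $L$-smooth and $\mu$-strongly convex function ($L,\mu>0$) with minimizer $x^*$, and suppose one has access to a gradient $\widetilde\nabla f$ of $f$ with relative noise $\hat\varepsilon\in[0,1]$. Let $\hat\varepsilon$ be small enough, namely $$\hat\varepsilon\lesssim\sqrt{\frac{\mu}{4L}}.$$ Let $x^0$ be the initial point and $R_0=\|x^0-x^*\|_2$. Then, in order to achieve an accuracy $\varepsilon$, defined as $f(x)-f(x^* )\le\varepsilon$, RISTM with intermediate parameter $p\in[1,2]$ requires $$K=\left\lceil\log_2\left(\frac{\mu R_0^2}{\varepsilon}\right)+1\right\rceil\ \text{restarts},\qquad N_{\text{total}}=\left\lceil\left(\frac{L}{\mu}\right)^{\frac1p}\log_2\left(\frac{\mu R_0^2}{\varepsilon}\right)\right\rceil\ \text{total oracle calls},$$ with $$N=\left\lceil\left(\frac{L}{\mu}\right)^{\frac1p}\right\rceil$$ iterations of ISTM at each restart and with the step size parameter $a$ chosen at each restart as $$a=O\left(\max\left\{1,\;N^{\frac p4}\sqrt{\hat\varepsilon},\;N^{\frac p2}\hat\varepsilon,\;N^p\hat\varepsilon^2\right\}\right).$$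
   Context: $\|\cdot\|_2$ is the Euclidean norm and $\langle\cdot,\cdot\rangle$ the standard inner product on $\mathbb{R}^n$; the problem is the unconstrained minimization of $f$ over $\mathbb{R}^n$. The symbol $\lesssim$ means inequality up to a numerical constant factor, and the choice $a=O(\max\{\dots\})$ means that $a$ is the indicated maximum times a suitable numerical constant. A differentiable $f:\mathbb{R}^n\to\mathbb{R}$ is $L$-smooth if $\|\nabla f(y)-\nabla f(x)\|_2\le L\|y-x\|_2$ for all $x,y$, and $\mu$-strongly convex if $f(y)\ge f(x)+\langle\nabla f(x),y-x\rangle+\frac{\mu}{2}\|y-x\|_2^2$ for all $x,y$. A gradient with relative noise $\hat\varepsilon\in[0,1]$ is an oracle returning $\widetilde\nabla f(x)$ with $\|\widetilde\nabla f(x)-\nabla f(x)\|_2\le\hat\varepsilon\|\nabla f(x)\|_2$ for all $x$; each evaluation of $\widetilde\nabla f$ is one oracle call. Intermediate Similar Triangle Method (ISTM) with initial point $x^0$, number of iterations $N$, smoothness constant $L>0$, step size parameter $a\ge1$, intermediate parameter $p\in[1,2]$: set $A_0=\alpha_0=0$, $y^0=z^0=x^0$; for $k=0,1,\dots,N-1$ set $$\alpha_{k+1}=\frac{(k+2)^{p-1}}{2aL},\qquad A_{k+1}=A_k+\alpha_{k+1},\qquad x^{k+1}=\frac{1}{A_{k+1}}\left(A_ky^k+\alpha_{k+1}z^k\right),$$ $$z^{k+1}=z^k-\alpha_{k+1}\widetilde\nabla f(x^{k+1}),\qquad y^{k+1}=\frac{1}{A_{k+1}}\left(A_ky^k+\alpha_{k+1}z^{k+1}\right).$$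 The output is $y^N$. Restarted Intermediate Similar Triangle Method (RISTM) with $K$ restarts: run ISTM from the given initial point $x^0$; then, at each subsequent restart, run ISTM again with the output of the previous run as the new initial point. The output of the $K$-th run is the output of RISTM. Here every run uses the smoothness constant $L$, the same $p$, and the $N$ and $a$ given in the claim.
   Formalization: N is taken as the ceiling of a numerical constant times (L/μ)^(1/p) (constant 1 fails for f=μx²/2); ε<2μR_0² is assumed so that K≥1; the oracle calls equal N_total only up to a numerical constant, for ε≤μR_0²/2, since K·N exceeds the displayed N_total. *)

theory Defs
  imports "HOL-Analysis.Analysis"
begin

text \<open>
  The numerical constants of the theorem must not depend on the dimension, so the dimension
  \<open>n\<close> has to be quantified inside the formula, below the constants.  Therefore
  $R^n$ is not a type such as \<open>real ^ 'n\<close>, but the set of all real sequences that vanish from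
  index \<open>n\<close> on (this is also the carrier of the library's topology \<open>Euclidean_space n\<close>).
\<close>

type_synonym vec = "nat \<Rightarrow> real"

definition Rn :: "nat \<Rightarrow> vec set" where
  "Rn n = {x. \<forall>i\<ge>n. x i = 0}"

definition ip :: "nat \<Rightarrow> vec \<Rightarrow> vec \<Rightarrow> real" where
  "ip n x y = (\<Sum>i<n. x i * y i)"

definition nrm :: "nat \<Rightarrow> vec \<Rightarrow> real" where
  "nrm n x = L2_set x {..<n}"

definition vdiff :: "vec \<Rightarrow> vec \<Rightarrow> vec" where
  "vdiff x y = (\<lambda>i. x i - y i)"

text \<open>\<open>f\<close> is (Frechet) differentiable on $R^n$ with gradient \<open>g\<close>.\<close>

definition is_gradient :: "nat \<Rightarrow> (vec \<Rightarrow> real) \<Rightarrow> (vec \<Rightarrow> vec) \<Rightarrow> bool" where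
  "is_gradient n f g \<longleftrightarrow>
     (\<forall>x\<in>Rn n. g x \<in> Rn n \<and>
        (\<forall>e>0. \<exists>d>0. \<forall>y\<in>Rn n. nrm n (vdiff y x) < d \<longrightarrow>
           \<bar>f y - f x - ip n (g x) (vdiff y x)\<bar> \<le> e * nrm n (vdiff y x)))"

definition L_smooth :: "nat \<Rightarrow> real \<Rightarrow> (vec \<Rightarrow> real) \<Rightarrow> (vec \<Rightarrow> vec) \<Rightarrow> bool" where
  "L_smooth n L f g \<longleftrightarrow> is_gradient n f g \<and>
     (\<forall>x\<in>Rn n. \<forall>y\<in>Rn n. nrm n (vdiff (g y) (g x)) \<le> L * nrm n (vdiff y x))"

definition strongly_convex :: "nat \<Rightarrow> real \<Rightarrow> (vec \<Rightarrow> real) \<Rightarrow> (vec \<Rightarrow> vec) \<Rightarrow> bool" where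
  "strongly_convex n \<mu> f g \<longleftrightarrow> is_gradient n f g \<and>
     (\<forall>x\<in>Rn n. \<forall>y\<in>Rn n.
        f y \<ge> f x + ip n (g x) (vdiff y x) + \<mu> / 2 * (nrm n (vdiff y x))\<^sup>2)"

definition is_minimizer :: "nat \<Rightarrow> (vec \<Rightarrow> real) \<Rightarrow> vec \<Rightarrow> bool" where
  "is_minimizer n f xs \<longleftrightarrow> xs \<in> Rn n \<and> (\<forall>x\<in>Rn n. f xs \<le> f x)"

definition relative_noise_oracle ::
  "nat \<Rightarrow> real \<Rightarrow> (vec \<Rightarrow> vec) \<Rightarrow> (vec \<Rightarrow> vec) \<Rightarrow> bool" where
  "relative_noise_oracle n \<epsilon>h g G \<longleftrightarrow>
     (\<forall>x\<in>Rn n. G x \<in> Rn n \<and> nrm n (vdiff (G x) (g x)) \<le> \<epsilon>h * nrm n (g x))"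

primrec istm_alpha :: "real \<Rightarrow> real \<Rightarrow> real \<Rightarrow> nat \<Rightarrow> real" where
  "istm_alpha L a p 0 = 0"
| "istm_alpha L a p (Suc k) = (real k + 2) powr (p - 1) / (2 * a * L)"

primrec istm_A :: "real \<Rightarrow> real \<Rightarrow> real \<Rightarrow> nat \<Rightarrow> real" where
  "istm_A L a p 0 = 0"
| "istm_A L a p (Suc k) = istm_A L a p k + istm_alpha L a p (Suc k)"

text \<open>
  The state after \<open>k\<close> iterations is $(y^k, z^k, q)$, where \<open>q\<close> lists the points at which the
  oracle \<open>G\<close> has been called so far; its length is the number of oracle calls.
\<close>

primrec istm_state ::
  "(vec \<Rightarrow> vec) \<Rightarrow> real \<Rightarrow> real \<Rightarrow> real \<Rightarrow> vec \<Rightarrow> nat \<Rightarrow> vec \<times> vec \<times> vec list" where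
  "istm_state G L a p x0 0 = (x0, x0, [])"
| "istm_state G L a p x0 (Suc k) =
     (let (y, z, q) = istm_state G L a p x0 k;
          \<alpha> = istm_alpha L a p (Suc k);
          A = istm_A L a p k;
          A' = istm_A L a p (Suc k);
          x = (\<lambda>i. (1 / A') * (A * y i + \<alpha> * z i));
          g = G x;
          z' = (\<lambda>i. z i - \<alpha> * g i);
          y' = (\<lambda>i. (1 / A') * (A * y i + \<alpha> * z' i))
      in (y', z', q @ [x]))"

definition istm ::
  "(vec \<Rightarrow> vec) \<Rightarrow> real \<Rightarrow> real \<Rightarrow> real \<Rightarrow> nat \<Rightarrow> vec \<Rightarrow> vec \<times> vec list" where
  "istm G L a p N x0 = (let (y, z, q) = istm_state G L a p x0 N in (y, q))"

text \<open>The result of \<open>K\<close> runs, together with all points at which the oracle has been called.\<close>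

primrec ristm ::
  "(vec \<Rightarrow> vec) \<Rightarrow> real \<Rightarrow> real \<Rightarrow> real \<Rightarrow> nat \<Rightarrow> vec \<Rightarrow> nat \<Rightarrow> vec \<times> vec list" where
  "ristm G L a p N x0 0 = (x0, [])"
| "ristm G L a p N x0 (Suc K) =
     (let (x, q) = ristm G L a p N x0 K;
          (y, q') = istm G L a p N x
      in (y, q @ q'))"

definition ristm_output ::
  "(vec \<Rightarrow> vec) \<Rightarrow> real \<Rightarrow> real \<Rightarrow> real \<Rightarrow> nat \<Rightarrow> vec \<Rightarrow> nat \<Rightarrow> vec" where
  "ristm_output G L a p N x0 K = fst (ristm G L a p N x0 K)"

definition ristm_calls ::
  "(vec \<Rightarrow> vec) \<Rightarrow> real \<Rightarrow> real \<Rightarrow> real \<Rightarrow> nat \<Rightarrow> vec \<Rightarrow> nat \<Rightarrow> nat" where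
  "ristm_calls G L a p N x0 K = length (snd (ristm G L a p N x0 K))"

end

theory Submission
  imports Defs
begin

text \<open>
  Write \<open>A\<^sub>k\<close>, \<open>y\<^sub>k\<close>, \<open>z\<^sub>k\<close> for the quantities of one run, \<open>x*\<close> for the minimizer and
  \<open>\<epsilon>h\<close> for the noise level.  The proof rests on the potential
    \<open>\<Phi>\<^sub>k = A\<^sub>k (f y\<^sub>k - f x*) + |z\<^sub>k - x*|\<^sup>2 / 2\<close>.
  With exact gradients, if \<open>A\<^sub>k\<close> is at least a large constant times \<open>L \<alpha>\<^sub>k\<^sup>2\<close>, each iteration
  decreases it by a fixed fraction of \<open>\<alpha>\<^sup>2 |\<nabla>f|\<^sup>2\<close>, where \<open>\<alpha>\<close> is the step size and \<open>\<nabla>f\<close> the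
  gradient used.  The main effect of the noise is to add at most \<open>\<alpha> \<epsilon>h |\<nabla>f| |z\<^sub>k - x*|\<close>.  As this
  is proportional to the gradient, Young's inequality splits it into a part that the decrease
  absorbs and the rest \<open>\<epsilon>h\<^sup>2 |z\<^sub>k - x*|\<^sup>2 \<le> 2 \<epsilon>h\<^sup>2 \<Phi>\<^sub>k\<close>.
  So \<open>\<Phi>\<close> grows by a factor of at most \<open>1 + 2 \<epsilon>h\<^sup>2\<close> per iteration (\<open>similar_triangles_step\<close>),
  and stays bounded by \<open>2 \<Phi>\<^sub>0\<close> as long as \<open>N \<epsilon>h\<^sup>2 \<le> 1/4\<close>.  As \<open>A\<^sub>N\<close> grows like \<open>N\<^sup>p / (a L)\<close>,
  a run from distance \<open>R\<close> ends with an error of at most \<open>4 a L R\<^sup>2 / N\<^sup>p\<close> (\<open>istm_rate\<close>).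

  For \<open>N\<close> of the order of \<open>(L/\<mu>)\<close> to the power \<open>1/p\<close>, the assumption on \<open>\<epsilon>h\<close> says that
  \<open>N\<^sup>p \<epsilon>h\<^sup>2\<close> is small.  This has two effects: since \<open>p \<ge> 1\<close>, also \<open>N \<epsilon>h\<^sup>2\<close> is small, so that
  the rate holds, and the maximum in the choice of \<open>a\<close> is just \<open>1\<close>, so that \<open>a\<close> is a numerical
  constant.  Hence the error after a run is at most \<open>\<mu> R\<^sup>2 / 8\<close>.  By quadratic growth of \<open>f\<close>
  around \<open>x*\<close>, the squared distance to \<open>x*\<close> halves in each run, and logarithmically many
  restarts suffice.

  No constant is optimized.  In particular the upper bound for a smooth function (\<open>descent\<close>) and
  the growth around the minimizer (\<open>quadratic_growth\<close>) lose a factor of two against the sharp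
  inequalities, but follow from the convexity inequality at suitable points without any calculus.
\<close>

section \<open>Inner product and norm on sequences\<close>

lemma ip_add: "ip n (\<lambda>i. u i + v i) w = ip n u w + ip n v w"
  by (simp add: ip_def sum.distrib algebra_simps)

lemma ip_scale: "ip n (\<lambda>i. c * u i) w = c * ip n u w"
  by (simp add: ip_def sum_distrib_left algebra_simps)

lemma ip_commute: "ip n u v = ip n v u"
  by (simp add: ip_def mult.commute)

lemma ip_scale_right: "ip n w (\<lambda>i. c * u i) = c * ip n w u"
  by (simp add: ip_commute [of n w] ip_scale)

lemma ip_add_right: "ip n w (\<lambda>i. u i + v i) = ip n w u + ip n w v"
  by (simp add: ip_commute [of n w] ip_add)

lemma nrm_nonneg: "0 \<le> nrm n x"
  by (simp add: nrm_def L2_set_nonneg)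

lemma nrm_square: "(nrm n x)\<^sup>2 = ip n x x"
  by (simp add: nrm_def L2_set_def ip_def sum_nonneg power2_eq_square)

lemma ip_self_nonneg: "0 \<le> ip n x x"
  by (metis nrm_square zero_le_power2)

lemma nrm_scale: "nrm n (\<lambda>i. c * u i) = \<bar>c\<bar> * nrm n u"
proof (rule power2_eq_imp_eq)
  show "(nrm n (\<lambda>i. c * u i))\<^sup>2 = (\<bar>c\<bar> * nrm n u)\<^sup>2"
    by (simp add: nrm_square power_mult_distrib ip_scale ip_scale_right) (simp add: power2_eq_square)
qed (simp_all add: nrm_nonneg)

lemma Cauchy_Schwarz_ip: "\<bar>ip n u v\<bar> \<le> nrm n u * nrm n v"
proof -
  have "\<bar>ip n u v\<bar> \<le> (\<Sum>i<n. \<bar>u i\<bar> * \<bar>v i\<bar>)"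
    unfolding ip_def by (rule order_trans [OF sum_abs]) (simp add: abs_mult)
  also have "\<dots> \<le> nrm n u * nrm n v"
    unfolding nrm_def by (rule L2_set_mult_ineq)
  finally show ?thesis .
qed

lemma ip_vdiff_swap: "ip n w (vdiff x y) = - ip n w (vdiff y x)"
  by (simp add: ip_def vdiff_def sum_negf [symmetric] algebra_simps)

lemma nrm_vdiff_commute: "nrm n (vdiff x y) = nrm n (vdiff y x)"
  by (simp add: nrm_def L2_set_def vdiff_def power2_commute)

lemma Rn_linear_combination:
  assumes "u \<in> Rn n" "v \<in> Rn n"
  shows "(\<lambda>i. c * (s * u i + t * v i)) \<in> Rn n"
  using assms by (simp add: Rn_def)

lemma Rn_scaled_diff:
  assumes "u \<in> Rn n" "v \<in> Rn n"
  shows "(\<lambda>i. u i - t * v i) \<in> Rn n"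
  using assms by (simp add: Rn_def)

section \<open>Smooth strongly convex functions\<close>

locale smooth_strongly_convex =
  fixes n :: nat and f :: "vec \<Rightarrow> real" and g :: "vec \<Rightarrow> vec" and L \<mu> :: real and xs :: vec
  assumes L_pos: "0 < L" and mu_pos: "0 < \<mu>"
    and smooth: "L_smooth n L f g"
    and strong: "strongly_convex n \<mu> f g"
    and minimizer: "is_minimizer n f xs"
begin

lemma minimizer_Rn: "xs \<in> Rn n"
  using minimizer by (simp add: is_minimizer_def)

lemma minimal: "x \<in> Rn n \<Longrightarrow> f xs \<le> f x"
  using minimizer by (simp add: is_minimizer_def)

lemma strongly_convex_at:
  assumes "x \<in> Rn n" "y \<in> Rn n"
  shows "f x + ip n (g x) (vdiff y x) + \<mu> / 2 * (nrm n (vdiff y x))\<^sup>2 \<le> f y"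
  using strong assms by (auto simp: strongly_convex_def)

lemma convex_at:
  assumes "x \<in> Rn n" "y \<in> Rn n"
  shows "f x + ip n (g x) (vdiff y x) \<le> f y"
proof -
  have "0 \<le> \<mu> / 2 * (nrm n (vdiff y x))\<^sup>2"
    using mu_pos by simp
  then show ?thesis
    using strongly_convex_at [OF assms] by linarith
qed

lemma gradient_difference_le:
  assumes "x \<in> Rn n" "y \<in> Rn n"
  shows "ip n (g y) (vdiff y x) - ip n (g x) (vdiff y x) \<le> L * (nrm n (vdiff y x))\<^sup>2"
proof -
  have "ip n (g y) (vdiff y x) - ip n (g x) (vdiff y x) = ip n (vdiff (g y) (g x)) (vdiff y x)"
    unfolding ip_def vdiff_def by (simp add: sum_subtractf [symmetric] left_diff_distrib)
  also have "\<dots> \<le> nrm n (vdiff (g y) (g x)) * nrm n (vdiff y x)"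
    using Cauchy_Schwarz_ip abs_le_D1 by blast
  also have "\<dots> \<le> (L * nrm n (vdiff y x)) * nrm n (vdiff y x)"
    using smooth assms by (intro mult_right_mono nrm_nonneg) (auto simp: L_smooth_def)
  finally show ?thesis
    by (simp add: power2_eq_square)
qed

text \<open>
  The sharp constant is \<open>L / 2\<close>, obtained by integrating the gradient along the segment.
  For convex \<open>f\<close>, the convexity inequality at the end point \<open>y\<close> gives this version at once.
\<close>

lemma descent:
  assumes "x \<in> Rn n" "y \<in> Rn n"
  shows "f y \<le> f x + ip n (g x) (vdiff y x) + L * (nrm n (vdiff y x))\<^sup>2"
proof -
  have "ip n (g y) (vdiff x y) = - ip n (g y) (vdiff y x)"
    by (rule ip_vdiff_swap)
  then show ?thesis
    using convex_at [OF assms(2,1)] gradient_difference_le [OF assms] by linarith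
qed

lemma mu_le_L:
  assumes "x \<in> Rn n" "y \<in> Rn n" "nrm n (vdiff y x) \<noteq> 0"
  shows "\<mu> \<le> L"
proof -
  have "ip n (g y) (vdiff x y) = - ip n (g y) (vdiff y x)"
    by (rule ip_vdiff_swap)
  then have "\<mu> * (nrm n (vdiff y x))\<^sup>2 \<le> L * (nrm n (vdiff y x))\<^sup>2"
    using strongly_convex_at [OF assms(1,2)] strongly_convex_at [OF assms(2,1)]
      gradient_difference_le [OF assms(1,2)] nrm_vdiff_commute [of n x y]
    by simp
  then show ?thesis
    using assms(3) by simp
qed

text \<open>
  The sharp constant is \<open>\<mu> / 2\<close>, but it needs that the gradient vanishes at \<open>xs\<close>.  The constant
  \<open>\<mu> / 4\<close> follows from strong convexity at the midpoint of \<open>x\<close> and \<open>xs\<close>, where \<open>f\<close> is at least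
  \<open>f xs\<close> and where the gradient terms towards both end points cancel.
\<close>

lemma quadratic_growth:
  assumes "x \<in> Rn n"
  shows "\<mu> / 4 * (nrm n (vdiff x xs))\<^sup>2 \<le> f x - f xs"
proof -
  define m where "m = (\<lambda>i. (1/2) * (1 * x i + 1 * xs i))"
  have m: "m \<in> Rn n"
    unfolding m_def using assms minimizer_Rn by (rule Rn_linear_combination)
  have d1: "vdiff x m = (\<lambda>i. (1/2) * vdiff x xs i)" and d2: "vdiff xs m = (\<lambda>i. (-1/2) * vdiff x xs i)"
    by (auto simp: vdiff_def m_def fun_eq_iff field_simps)
  have n1: "nrm n (vdiff x m) = nrm n (vdiff x xs) / 2" and n2: "nrm n (vdiff xs m) = nrm n (vdiff x xs) / 2"
    unfolding d1 d2 nrm_scale by simp_all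
  have i1: "ip n (g m) (vdiff x m) = ip n (g m) (vdiff x xs) / 2"
    and i2: "ip n (g m) (vdiff xs m) = - ip n (g m) (vdiff x xs) / 2"
    unfolding d1 d2 ip_scale_right by simp_all
  show ?thesis
    using strongly_convex_at [OF m assms] strongly_convex_at [OF m minimizer_Rn] minimal [OF m]
    unfolding n1 n2 i1 i2 by (simp add: power_divide field_simps)
qed

end

section \<open>One iteration with relative noise\<close>

locale noisy_problem = smooth_strongly_convex +
  fixes G :: "vec \<Rightarrow> vec" and \<epsilon>h :: real
  assumes noise_nonneg: "0 \<le> \<epsilon>h" and noise_le_half: "\<epsilon>h \<le> 1 / 2"
    and noisy: "relative_noise_oracle n \<epsilon>h g G"
begin

lemma oracle_Rn: "x \<in> Rn n \<Longrightarrow> G x \<in> Rn n"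
  using noisy by (simp add: relative_noise_oracle_def)

lemma oracle_error: "x \<in> Rn n \<Longrightarrow> nrm n (vdiff (G x) (g x)) \<le> \<epsilon>h * nrm n (g x)"
  using noisy by (simp add: relative_noise_oracle_def)

text \<open>
  The iterate \<open>y'\<close> is the gradient step from \<open>x\<close> with step size \<open>\<alpha>\<^sup>2 / (A + \<alpha>)\<close>.  The linear term of
  \<open>descent\<close> and the square \<open>|z' - xs|\<^sup>2\<close> together contribute \<open>- \<alpha>\<^sup>2 |g x|\<^sup>2 / 2\<close>.  One
  half of it pays for the quadratic term of \<open>descent\<close> and for the square of the error, the other
  half for the first summand in Young's inequality applied to \<open>\<alpha> \<epsilon>h |g x| |z - xs|\<close>.
\<close>

lemma similar_triangles_step:
  fixes A \<alpha> :: real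
  assumes A: "0 \<le> A" and \<alpha>: "0 < \<alpha>" and step_size: "32 * L * \<alpha>\<^sup>2 \<le> A + \<alpha>"
    and y: "y \<in> Rn n" and z: "z \<in> Rn n"
    and x_def: "x = (\<lambda>i. (1 / (A + \<alpha>)) * (A * y i + \<alpha> * z i))"
    and z'_def: "z' = (\<lambda>i. z i - \<alpha> * G x i)"
    and y'_def: "y' = (\<lambda>i. (1 / (A + \<alpha>)) * (A * y i + \<alpha> * z' i))"
  shows "(A + \<alpha>) * (f y' - f xs) + (nrm n (vdiff z' xs))\<^sup>2 / 2
    \<le> A * (f y - f xs) + (nrm n (vdiff z xs))\<^sup>2 / 2 + \<epsilon>h\<^sup>2 * (nrm n (vdiff z xs))\<^sup>2"
proof -
  define B where "B = A + \<alpha>"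
  define e where "e = vdiff (G x) (g x)"
  define u where "u = vdiff z xs"
  have B: "0 < B"
    using A \<alpha> by (simp add: B_def)
  have x: "x \<in> Rn n"
    unfolding x_def using y z by (rule Rn_linear_combination)
  have z': "z' \<in> Rn n"
    unfolding z'_def using z oracle_Rn [OF x] by (rule Rn_scaled_diff)
  have y': "y' \<in> Rn n"
    unfolding y'_def using y z' by (rule Rn_linear_combination)
  have Gx: "G x = (\<lambda>i. g x i + e i)"
    by (simp add: e_def vdiff_def)

  have GG: "ip n (G x) (G x) = ip n (g x) (g x) + 2 * ip n (g x) e + ip n e e"
    and gG: "ip n (g x) (G x) = ip n (g x) (g x) + ip n (g x) e"
    and Gu: "ip n (G x) u = ip n (g x) u + ip n e u"
    unfolding Gx ip_add ip_add_right by (simp_all add: ip_commute [of n e "g x"])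
  have ee: "ip n e e \<le> ip n (g x) (g x) / 4"
  proof -
    have "nrm n e \<le> nrm n (g x) / 2"
      using oracle_error [OF x] mult_right_mono [OF noise_le_half nrm_nonneg [of n "g x"]]
      unfolding e_def by linarith
    then have "(nrm n e)\<^sup>2 \<le> (nrm n (g x) / 2)\<^sup>2"
      by (intro power_mono nrm_nonneg)
    then show ?thesis
      by (simp add: nrm_square power_divide)
  qed
  have GG_le: "ip n (G x) (G x) \<le> 4 * ip n (g x) (g x)"
  proof -
    have "0 \<le> ip n (\<lambda>i. g x i + (-1) * e i) (\<lambda>i. g x i + (-1) * e i)"
      by (rule ip_self_nonneg)
    then have "2 * ip n (g x) e \<le> ip n (g x) (g x) + ip n e e"
      unfolding ip_add ip_add_right ip_scale ip_scale_right by (simp add: ip_commute [of n e "g x"])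
    then show ?thesis
      using ee GG ip_self_nonneg [of n "g x"] by linarith
  qed

  have fy': "B * f y' \<le> B * f x - \<alpha>\<^sup>2 * ip n (g x) (G x) + \<alpha>\<^sup>2 * ip n (g x) (g x) / 8"
  proof -
    have d: "vdiff y' x = (\<lambda>i. (- (\<alpha>\<^sup>2 / B)) * G x i)"
      using B unfolding vdiff_def y'_def z'_def B_def [symmetric]
      by (subst x_def) (simp add: fun_eq_iff B_def [symmetric] field_simps power2_eq_square)
    have q: "(nrm n (vdiff y' x))\<^sup>2 = (\<alpha>\<^sup>2 / B)\<^sup>2 * ip n (G x) (G x)"
      unfolding d nrm_scale using B by (simp add: power_mult_distrib power_divide nrm_square)
    have "f y' \<le> f x - \<alpha>\<^sup>2 / B * ip n (g x) (G x) + L * ((\<alpha>\<^sup>2 / B)\<^sup>2 * ip n (G x) (G x))"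
      using descent [OF x y'] unfolding q unfolding d ip_scale_right by simp
    then have "B * f y' \<le> B * (f x - \<alpha>\<^sup>2 / B * ip n (g x) (G x)
        + L * ((\<alpha>\<^sup>2 / B)\<^sup>2 * ip n (G x) (G x)))"
      using B by simp
    also have "\<dots> = B * f x - \<alpha>\<^sup>2 * ip n (g x) (G x) + (L * \<alpha>\<^sup>2 / B) * (\<alpha>\<^sup>2 * ip n (G x) (G x))"
      using B by (simp add: field_simps power2_eq_square)
    also have "(L * \<alpha>\<^sup>2 / B) * (\<alpha>\<^sup>2 * ip n (G x) (G x)) \<le> (1 / 32) * (\<alpha>\<^sup>2 * (4 * ip n (g x) (g x)))"
      using step_size B L_pos GG_le ip_self_nonneg [of n "G x"]
      by (intro mult_mono mult_left_mono mult_nonneg_nonneg)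
        (simp_all add: B_def [symmetric] field_simps)
    finally show ?thesis
      by simp
  qed

  have zz: "(nrm n (vdiff z' xs))\<^sup>2 = ip n u u - 2 * \<alpha> * ip n (G x) u + \<alpha>\<^sup>2 * ip n (G x) (G x)"
  proof -
    have d: "vdiff z' xs = (\<lambda>i. u i + (-\<alpha>) * G x i)"
      by (simp add: vdiff_def z'_def u_def fun_eq_iff)
    show ?thesis
      unfolding nrm_square d ip_add ip_add_right ip_scale ip_scale_right ip_commute [of n u "G x"]
      by (simp add: power2_eq_square)
  qed

  have conv: "A * (f x - f y) + \<alpha> * (f x - f xs) \<le> \<alpha> * ip n (g x) u"
  proof -
    \<comment> \<open>\<open>x\<close> is the average of \<open>y\<close> and \<open>z\<close> with weights \<open>A\<close> and \<open>\<alpha>\<close>.\<close>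
    have "(\<lambda>i. A * vdiff y x i + \<alpha> * vdiff xs x i) = (\<lambda>i. (-\<alpha>) * u i)"
    proof
      fix i
      have "B * x i = A * y i + \<alpha> * z i"
        using B by (subst x_def) (simp add: B_def)
      then show "A * vdiff y x i + \<alpha> * vdiff xs x i = (-\<alpha>) * u i"
        by (simp add: vdiff_def u_def B_def algebra_simps)
    qed
    then have "A * ip n (g x) (vdiff y x) + \<alpha> * ip n (g x) (vdiff xs x) = (-\<alpha>) * ip n (g x) u"
      by (metis ip_add_right ip_scale_right)
    moreover have "A * (f x + ip n (g x) (vdiff y x)) \<le> A * f y"
      using convex_at [OF x y] A by (rule mult_left_mono)
    moreover have "\<alpha> * (f x + ip n (g x) (vdiff xs x)) \<le> \<alpha> * f xs"
      using convex_at [OF x minimizer_Rn] \<alpha> by simp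
    ultimately show ?thesis
      by (simp add: algebra_simps)
  qed

  have young: "- \<alpha> * ip n e u \<le> \<alpha>\<^sup>2 * ip n (g x) (g x) / 4 + \<epsilon>h\<^sup>2 * ip n u u"
  proof -
    have "- ip n e u \<le> nrm n e * nrm n u"
      using Cauchy_Schwarz_ip [of n e u] by linarith
    also have "\<dots> \<le> (\<epsilon>h * nrm n (g x)) * nrm n u"
      using oracle_error [OF x] unfolding e_def by (intro mult_right_mono nrm_nonneg)
    finally have "\<alpha> * (- ip n e u) \<le> \<alpha> * ((\<epsilon>h * nrm n (g x)) * nrm n u)"
      using \<alpha> by (intro mult_left_mono) simp_all
    moreover have "0 \<le> (\<alpha> * nrm n (g x) / 2 - \<epsilon>h * nrm n u)\<^sup>2"
      by simp
    ultimately show ?thesis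
      unfolding nrm_square [symmetric] by (simp add: power2_eq_square algebra_simps)
  qed

  have err: "\<alpha>\<^sup>2 * ip n e e \<le> \<alpha>\<^sup>2 * (ip n (g x) (g x) / 4)"
    using ee by (intro mult_left_mono) auto
  have "B * f y' + (nrm n (vdiff z' xs))\<^sup>2 / 2
      \<le> B * f x + ip n u u / 2 - \<alpha> * ip n (g x) u + \<epsilon>h\<^sup>2 * ip n u u"
    using fy' zz young err unfolding GG gG Gu by (simp add: algebra_simps)
  then show ?thesis
    using conv unfolding u_def [symmetric] nrm_square [of n u] B_def
    by (simp add: algebra_simps)
qed

end

section \<open>Growth of the step size sums\<close>

lemma powr_increment_le:
  fixes m p :: real
  assumes "0 \<le> m" "1 \<le> p" "p \<le> 2"
  shows "(m + 1) powr p - m powr p \<le> 2 * (m + 1) powr (p - 1)"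
proof -
  define t where "t = m / (m + 1)"
  have t: "0 \<le> t" "t \<le> 1" "t = 1 - 1 / (m + 1)"
    using assms by (auto simp: t_def field_simps)
  \<comment> \<open>Bernoulli's inequality for \<open>t\<close> squared bounds all smaller exponents as well.\<close>
  have "1 - 2 / (m + 1) \<le> t\<^sup>2"
    unfolding t(3) using assms by (simp add: power2_diff)
  also have "t\<^sup>2 = t powr 2"
    using t by simp
  also have "t powr 2 \<le> t powr p"
    using t(1,2) assms by (cases "t = 0") (simp_all add: powr_mono' del: powr_numeral)
  also have "t powr p = m powr p / (m + 1) powr p"
    unfolding t_def using assms by (simp add: powr_divide)
  finally have "(1 - 2 / (m + 1)) * (m + 1) powr p \<le> m powr p"
    using assms by (simp add: field_simps)
  moreover have "(m + 1) powr p = (m + 1) * (m + 1) powr (p - 1)"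
    using assms powr_add [of "m + 1" 1 "p - 1"] by simp
  moreover have "(1 - 2 / (m + 1)) * ((m + 1) * (m + 1) powr (p - 1))
      = (m + 1) * (m + 1) powr (p - 1) - 2 * (m + 1) powr (p - 1)"
    using assms(1) by (simp add: left_diff_distrib)
  ultimately show ?thesis
    by simp
qed

lemma istm_A_lower_bound:
  assumes "0 < L" "0 < a" "1 \<le> p" "p \<le> 2"
  shows "real k powr p / (4 * a * L) \<le> istm_A L a p k"
proof (induction k)
  case 0
  then show ?case by simp
next
  case (Suc k)
  have "(real k + 1) powr p - real k powr p \<le> 2 * (real k + 1) powr (p - 1)"
    using assms by (intro powr_increment_le) auto
  also have "\<dots> \<le> 2 * (real k + 2) powr (p - 1)"
    using assms by (intro mult_left_mono powr_mono2) auto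
  finally have "((real k + 1) powr p - real k powr p) / (4 * a * L)
      \<le> 2 * (real k + 2) powr (p - 1) / (4 * a * L)"
    using assms by (intro divide_right_mono) auto
  with Suc.IH have "(real k + 1) powr p / (4 * a * L)
      \<le> istm_A L a p k + 2 * (real k + 2) powr (p - 1) / (4 * a * L)"
    unfolding diff_divide_distrib by linarith
  then show ?case
    by (simp add: ac_simps)
qed

text \<open>
  Up to constants, \<open>L \<alpha>\<^sup>2\<close> is \<open>m powr (2 * p - 2) / (a\<^sup>2 * L)\<close> with \<open>m = k + 2\<close>, while the sum of the
  step sizes is \<open>m powr p / (a * L)\<close>.  The exponents compare as needed because \<open>p \<le> 2\<close>.
\<close>

lemma istm_step_size:
  assumes "0 < L" "128 \<le> a" "1 \<le> p" "p \<le> 2"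
  shows "32 * L * (istm_alpha L a p (Suc k))\<^sup>2 \<le> istm_A L a p (Suc k)"
proof -
  define m where "m = real k + 2"
  have m: "1 \<le> m" "m / 2 \<le> real (Suc k)"
    by (auto simp: m_def)
  have "2 powr p \<le> (2::real) powr 2"
    using assms by (intro powr_mono) auto
  then have "m powr p / 4 \<le> m powr p / 2 powr p"
    by (intro divide_left_mono) auto
  also have "\<dots> = (m / 2) powr p"
    using m by (simp add: powr_divide)
  also have "\<dots> \<le> real (Suc k) powr p"
    using m assms by (intro powr_mono2) auto
  finally have S: "m powr p / 4 \<le> real (Suc k) powr p" .
  have "(m powr (p - 1))\<^sup>2 = m powr (2 * p - 2)"
    by (simp add: power2_eq_square powr_add [symmetric])
  also have "\<dots> \<le> m powr p"
    using m assms by (intro powr_mono) auto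
  finally have q: "(m powr (p - 1))\<^sup>2 \<le> m powr p" .
  have "32 * L * (istm_alpha L a p (Suc k))\<^sup>2 = 8 * (m powr (p - 1))\<^sup>2 / (a * (a * L))"
    using assms by (simp add: m_def power2_eq_square field_simps)
  also have "\<dots> \<le> 8 * m powr p / (128 * (a * L))"
    using assms q by (intro frac_le mult_left_mono mult_right_mono) auto
  also have "\<dots> = (m powr p / 4) / (4 * a * L)"
    by simp
  also have "\<dots> \<le> real (Suc k) powr p / (4 * a * L)"
    using S assms by (intro divide_right_mono) auto
  also have "\<dots> \<le> istm_A L a p (Suc k)"
    using assms by (intro istm_A_lower_bound) auto
  finally show ?thesis .
qed

section \<open>One run\<close>

lemma istm_A_nonneg:
  assumes "0 < L" "0 < a" "1 \<le> p" "p \<le> 2"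
  shows "0 \<le> istm_A L a p k"
  by (rule order_trans [OF _ istm_A_lower_bound [OF assms]]) (use assms in simp)

context noisy_problem
begin

lemma istm_potential:
  assumes "128 \<le> a" "1 \<le> p" "p \<le> 2" "x0 \<in> Rn n" "istm_state G L a p x0 k = (y, z, q)"
  shows "y \<in> Rn n \<and> z \<in> Rn n \<and>
    istm_A L a p k * (f y - f xs) + (nrm n (vdiff z xs))\<^sup>2 / 2
      \<le> (1 + 2 * \<epsilon>h\<^sup>2) ^ k * ((nrm n (vdiff x0 xs))\<^sup>2 / 2)"
  using assms(5)
proof (induction k arbitrary: y z q)
  case 0
  then have "y = x0" "z = x0"
    by auto
  then show ?case
    using assms(4) by simp
next
  case (Suc k)
  obtain y1 z1 q1 where s: "istm_state G L a p x0 k = (y1, z1, q1)"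
    using prod_cases3 by blast
  define A \<alpha> where "A = istm_A L a p k" and "\<alpha> = istm_alpha L a p (Suc k)"
  have A': "istm_A L a p (Suc k) = A + \<alpha>"
    by (simp add: A_def \<alpha>_def)
  define x where "x = (\<lambda>i. (1 / (A + \<alpha>)) * (A * y1 i + \<alpha> * z1 i))"
  have z: "z = (\<lambda>i. z1 i - \<alpha> * G x i)" and y: "y = (\<lambda>i. (1 / (A + \<alpha>)) * (A * y1 i + \<alpha> * z i))"
    using Suc.prems s unfolding istm_state.simps A' A_def [symmetric] \<alpha>_def [symmetric]
    by (auto simp: Let_def x_def)
  note IH = Suc.IH [OF s, folded A_def]
  have y1: "y1 \<in> Rn n" and z1: "z1 \<in> Rn n"
    using IH by auto
  have x: "x \<in> Rn n"
    unfolding x_def using y1 z1 by (rule Rn_linear_combination)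
  have zR: "z \<in> Rn n"
    unfolding z using z1 oracle_Rn [OF x] by (rule Rn_scaled_diff)
  have yR: "y \<in> Rn n"
    unfolding y using y1 zR by (rule Rn_linear_combination)
  have A: "0 \<le> A"
    unfolding A_def using assms L_pos by (intro istm_A_nonneg) auto
  have \<alpha>: "0 < \<alpha>"
    unfolding \<alpha>_def using assms L_pos by simp
  have gap: "0 \<le> A * (f y1 - f xs)"
    using A minimal [OF y1] by simp
  have "(A + \<alpha>) * (f y - f xs) + (nrm n (vdiff z xs))\<^sup>2 / 2
      \<le> A * (f y1 - f xs) + (nrm n (vdiff z1 xs))\<^sup>2 / 2 + \<epsilon>h\<^sup>2 * (nrm n (vdiff z1 xs))\<^sup>2"
    using A \<alpha> _ y1 z1 x_def z y
    by (rule similar_triangles_step)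
      (use istm_step_size [of L a p k] L_pos assms in \<open>simp only: A' \<alpha>_def\<close>)
  also have "\<dots> \<le> (1 + 2 * \<epsilon>h\<^sup>2) * (A * (f y1 - f xs) + (nrm n (vdiff z1 xs))\<^sup>2 / 2)"
    using mult_nonneg_nonneg [OF zero_le_power2 [of \<epsilon>h] gap]
    by (simp add: distrib_right distrib_left add_divide_distrib mult.assoc)
  also have "\<dots> \<le> (1 + 2 * \<epsilon>h\<^sup>2) * ((1 + 2 * \<epsilon>h\<^sup>2) ^ k * ((nrm n (vdiff x0 xs))\<^sup>2 / 2))"
    using IH by (intro mult_left_mono) auto
  finally show ?case
    using yR zR by (simp only: A' power_Suc mult.assoc simp_thms)
qed

lemma istm_Rn:
  assumes "128 \<le> a" "1 \<le> p" "p \<le> 2" "x0 \<in> Rn n"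
  shows "fst (istm G L a p N x0) \<in> Rn n"
  using istm_potential [OF assms] by (auto simp: istm_def split: prod.split)

lemma istm_rate:
  assumes a: "128 \<le> a" and p: "1 \<le> p" "p \<le> 2" and x0: "x0 \<in> Rn n"
    and N: "0 < N" and few: "real N * \<epsilon>h\<^sup>2 \<le> 1 / 4"
  shows "f (fst (istm G L a p N x0)) - f xs \<le> 4 * a * L * (nrm n (vdiff x0 xs))\<^sup>2 / real N powr p"
proof -
  obtain y z q where s: "istm_state G L a p x0 N = (y, z, q)"
    using prod_cases3 by blast
  note P = istm_potential [OF a p x0 s]
  have "(1 + 2 * \<epsilon>h\<^sup>2) ^ N \<le> exp (2 * \<epsilon>h\<^sup>2) ^ N"
    by (intro power_mono exp_ge_add_one_self) auto
  also have "\<dots> = exp (2 * (real N * \<epsilon>h\<^sup>2))"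
    by (simp add: exp_of_nat_mult [symmetric] algebra_simps)
  also have "\<dots> \<le> exp (1 / 2)"
    using few by simp
  also have "\<dots> \<le> 2"
    using exp_bound_half [of "1/2::real"] by simp
  finally have "(1 + 2 * \<epsilon>h\<^sup>2) ^ N * ((nrm n (vdiff x0 xs))\<^sup>2 / 2) \<le> 2 * ((nrm n (vdiff x0 xs))\<^sup>2 / 2)"
    by (intro mult_right_mono) auto
  moreover have "0 \<le> (nrm n (vdiff z xs))\<^sup>2 / 2"
    by simp
  ultimately have "istm_A L a p N * (f y - f xs) \<le> (nrm n (vdiff x0 xs))\<^sup>2"
    using P by linarith
  moreover have "real N powr p / (4 * a * L) * (f y - f xs) \<le> istm_A L a p N * (f y - f xs)"
    using istm_A_lower_bound [of L a p N] L_pos a p P minimal by (intro mult_right_mono) auto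
  ultimately have "real N powr p / (4 * a * L) * (f y - f xs) \<le> (nrm n (vdiff x0 xs))\<^sup>2"
    by linarith
  then have "f y - f xs \<le> 4 * a * L * (nrm n (vdiff x0 xs))\<^sup>2 / real N powr p"
    using N L_pos a by (simp add: field_simps)
  then show ?thesis
    by (simp add: istm_def s)
qed

section \<open>Restarts\<close>

lemma ristm_error:
  assumes a: "128 \<le> a" and p: "1 \<le> p" "p \<le> 2" and x0: "x0 \<in> Rn n"
    and N: "0 < N" and few: "real N * \<epsilon>h\<^sup>2 \<le> 1 / 4"
    and long: "32 * a * L \<le> \<mu> * real N powr p"
  shows "ristm_output G L a p N x0 K \<in> Rn n \<and>
    (nrm n (vdiff (ristm_output G L a p N x0 K) xs))\<^sup>2 \<le> (nrm n (vdiff x0 xs))\<^sup>2 / 2 ^ K \<and>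
    (0 < K \<longrightarrow> f (ristm_output G L a p N x0 K) - f xs \<le> \<mu> * (nrm n (vdiff x0 xs))\<^sup>2 / (4 * 2 ^ K))"
proof (induction K)
  case 0
  then show ?case
    using x0 by (simp add: ristm_output_def)
next
  case (Suc K)
  define x where "x = ristm_output G L a p N x0 K"
  define y where "y = ristm_output G L a p N x0 (Suc K)"
  define D where "D = (nrm n (vdiff x0 xs))\<^sup>2 / 2 ^ K"
  have y_eq: "y = fst (istm G L a p N x)"
    by (simp add: y_def x_def ristm_output_def split: prod.split)
  have x: "x \<in> Rn n" and D: "(nrm n (vdiff x xs))\<^sup>2 \<le> D"
    using Suc.IH by (auto simp: x_def D_def)
  have y: "y \<in> Rn n"
    unfolding y_eq using a p x by (rule istm_Rn)
  have "f y - f xs \<le> 4 * a * L * (nrm n (vdiff x xs))\<^sup>2 / real N powr p"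
    unfolding y_eq using a p x N few by (rule istm_rate)
  also have "\<dots> \<le> (4 * a * L / real N powr p) * D"
    using D a L_pos mult_left_mono [OF D, of "4 * a * L / real N powr p"] by simp
  also have "\<dots> \<le> \<mu> / 8 * D"
    using long N by (intro mult_right_mono) (auto simp: D_def field_simps)
  finally have gap: "f y - f xs \<le> \<mu> / 8 * D" .
  with quadratic_growth [OF y] have "\<mu> / 4 * (nrm n (vdiff y xs))\<^sup>2 \<le> \<mu> / 4 * (D / 2)"
    by simp
  then have "(nrm n (vdiff y xs))\<^sup>2 \<le> D / 2"
    using mu_pos by simp
  with y gap show ?case
    unfolding y_def [symmetric] by (simp add: D_def field_simps)
qed

end

lemma length_istm_calls: "length (snd (istm G L a p N x0)) = N"
proof -
  have "length (snd (snd (istm_state G L a p x0 k))) = k" for k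
    by (induction k) (auto simp: Let_def split: prod.split)
  from this [of N] show ?thesis
    by (cases "istm_state G L a p x0 N") (simp add: istm_def)
qed

lemma ristm_calls_eq: "ristm_calls G L a p N x0 K = K * N"
proof (induction K)
  case 0
  then show ?case by (simp add: ristm_calls_def)
next
  case (Suc K)
  obtain x q where xq: "ristm G L a p N x0 K = (x, q)"
    by fastforce
  have "length (snd (istm G L a p N x)) = N"
    by (rule length_istm_calls)
  with Suc show ?case
    by (cases "istm G L a p N x") (simp add: ristm_calls_def xq)
qed

section \<open>The complexity bound\<close>

text \<open>
  All four entries are powers of \<open>s = real N powr (p / 2) * \<epsilon>h\<close>, with exponents \<open>0\<close>, \<open>1 / 2\<close>, \<open>1\<close>
  and \<open>2\<close>.
\<close>

lemma step_parameter_Max_eq_1: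
  assumes "0 \<le> \<epsilon>h" "real N powr p * \<epsilon>h\<^sup>2 \<le> 1"
  shows "Max {1, real N powr (p / 4) * sqrt \<epsilon>h, real N powr (p / 2) * \<epsilon>h, real N powr p * \<epsilon>h\<^sup>2} = 1"
proof -
  define s where "s = real N powr (p / 2) * \<epsilon>h"
  have s0: "0 \<le> s"
    using assms by (simp add: s_def)
  have sq: "s\<^sup>2 = real N powr p * \<epsilon>h\<^sup>2"
    by (simp add: s_def power_mult_distrib power2_eq_square powr_add [symmetric])
  have s1: "s \<le> 1"
    using assms(2) s0 unfolding sq [symmetric] by (simp add: power_le_one_iff abs_square_le_1)
  have "(real N powr (p / 4))\<^sup>2 = real N powr (p / 2)"
    by (simp add: power2_eq_square powr_add [symmetric])
  then have rt: "(real N powr (p / 4) * sqrt \<epsilon>h)\<^sup>2 = s"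
    using assms(1) by (simp add: s_def power_mult_distrib)
  have "real N powr (p / 4) * sqrt \<epsilon>h \<le> 1"
    using s1 unfolding rt [symmetric] by (simp add: abs_square_le_1)
  then show ?thesis
    using s1 assms(2) unfolding s_def [symmetric] by (intro Max_eqI) auto
qed

theorem theorem3p2:
  shows "\<exists>c Ca CN Ct :: real. 0 < c \<and> 1 \<le> Ca \<and> 1 \<le> CN \<and> 1 \<le> Ct \<and>
    (\<forall>(n :: nat) (f :: vec \<Rightarrow> real) (g :: vec \<Rightarrow> vec) (G :: vec \<Rightarrow> vec)
       (L :: real) (\<mu> :: real) (\<epsilon>h :: real) (p :: real) (\<epsilon> :: real)
       (x0 :: vec) (xs :: vec) (R0 :: real) (N :: nat) (a :: real) (K :: nat).
       0 < L \<longrightarrow> 0 < \<mu> \<longrightarrow>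
       L_smooth n L f g \<longrightarrow> strongly_convex n \<mu> f g \<longrightarrow> is_minimizer n f xs \<longrightarrow>
       0 \<le> \<epsilon>h \<longrightarrow> \<epsilon>h \<le> 1 \<longrightarrow> relative_noise_oracle n \<epsilon>h g G \<longrightarrow>
       \<epsilon>h \<le> c * sqrt (\<mu> / (4 * L)) \<longrightarrow>
       1 \<le> p \<longrightarrow> p \<le> 2 \<longrightarrow>
       x0 \<in> Rn n \<longrightarrow> R0 = nrm n (vdiff x0 xs) \<longrightarrow>
       0 < \<epsilon> \<longrightarrow> \<epsilon> < 2 * (\<mu> * R0\<^sup>2) \<longrightarrow>
       K = nat \<lceil>log 2 (\<mu> * R0\<^sup>2 / \<epsilon>) + 1\<rceil> \<longrightarrow>
       N = nat \<lceil>CN * (L / \<mu>) powr (1 / p)\<rceil> \<longrightarrow>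
       a = Ca * Max {1, real N powr (p / 4) * sqrt \<epsilon>h, real N powr (p / 2) * \<epsilon>h,
                     real N powr p * \<epsilon>h\<^sup>2} \<longrightarrow>
       f (ristm_output G L a p N x0 K) - f xs \<le> \<epsilon> \<and>
       (\<epsilon> \<le> \<mu> * R0\<^sup>2 / 2 \<longrightarrow>
          real_of_int \<lceil>(L / \<mu>) powr (1 / p) * log 2 (\<mu> * R0\<^sup>2 / \<epsilon>)\<rceil>
            \<le> real (ristm_calls G L a p N x0 K) \<and>
          real (ristm_calls G L a p N x0 K)
            \<le> Ct * real_of_int \<lceil>(L / \<mu>) powr (1 / p) * log 2 (\<mu> * R0\<^sup>2 / \<epsilon>)\<rceil>))"
proof -
  \<comment> \<open>\<open>a = 128\<close> is the least value admitted by \<open>istm_step_size\<close>; \<open>4096 = 32 * 128\<close> makes a run long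
    enough in the sense of \<open>ristm_error\<close>; and \<open>c = 1 / (2 * 4096)\<close> gives \<open>N powr p * \<epsilon>h\<^sup>2 \<le> 1 / 4\<close>.
    With \<open>l\<close> the logarithm, \<open>24576 = 3 * 8192\<close> comes from \<open>K \<le> 3 * l\<close> and \<open>N \<le> 8192 * (L / \<mu>) powr (1 / p)\<close>.\<close>
  have main: "f (ristm_output G L a p N x0 K) - f xs \<le> \<epsilon> \<and>
       (\<epsilon> \<le> \<mu> * R0\<^sup>2 / 2 \<longrightarrow>
          real_of_int \<lceil>(L / \<mu>) powr (1 / p) * log 2 (\<mu> * R0\<^sup>2 / \<epsilon>)\<rceil>
            \<le> real (ristm_calls G L a p N x0 K) \<and>
          real (ristm_calls G L a p N x0 K)
            \<le> 24576 * real_of_int \<lceil>(L / \<mu>) powr (1 / p) * log 2 (\<mu> * R0\<^sup>2 / \<epsilon>)\<rceil>)"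
    if L: "0 < L" and \<mu>: "0 < \<mu>"
      and smooth: "L_smooth n L f g" and strong: "strongly_convex n \<mu> f g"
      and minimizer: "is_minimizer n f xs"
      and \<epsilon>h: "0 \<le> \<epsilon>h" and noisy: "relative_noise_oracle n \<epsilon>h g G"
      and small: "\<epsilon>h \<le> 1 / 8192 * sqrt (\<mu> / (4 * L))"
      and p: "1 \<le> p" "p \<le> 2" and x0: "x0 \<in> Rn n" and R0: "R0 = nrm n (vdiff x0 xs)"
      and \<epsilon>: "0 < \<epsilon>" "\<epsilon> < 2 * (\<mu> * R0\<^sup>2)"
      and K: "K = nat \<lceil>log 2 (\<mu> * R0\<^sup>2 / \<epsilon>) + 1\<rceil>"
      and N: "N = nat \<lceil>4096 * (L / \<mu>) powr (1 / p)\<rceil>"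
      and a: "a = 128 * Max {1, real N powr (p / 4) * sqrt \<epsilon>h, real N powr (p / 2) * \<epsilon>h,
                     real N powr p * \<epsilon>h\<^sup>2}"
    for n f g G L \<mu> \<epsilon>h p \<epsilon> x0 xs R0 N a K
  proof -
    interpret smooth_strongly_convex n f g L \<mu> xs
      using L \<mu> smooth strong minimizer by unfold_locales
    have R0_nz: "R0 \<noteq> 0"
      using \<epsilon> by auto
    then have "\<mu> \<le> L"
      using mu_le_L [OF minimizer_Rn x0] R0 by simp
    then have ratio: "1 \<le> L / \<mu>"
      using \<mu> by simp
    define s where "s = (L / \<mu>) powr (1 / p)"
    have s: "1 \<le> s"
      unfolding s_def using ratio p by (intro ge_one_powr_ge_zero) auto
    have sp: "s powr p = L / \<mu>"
      unfolding s_def using L \<mu> p by (simp add: powr_powr)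
    have N_lower: "4096 * s \<le> real N" and N_upper: "real N \<le> 8192 * s"
    proof -
      have "real N = real_of_int \<lceil>4096 * s\<rceil>"
        unfolding N s_def [symmetric] using s by simp
      then show "4096 * s \<le> real N" "real N \<le> 8192 * s"
        using s by linarith+
    qed
    have N_pos: "0 < N"
      using N_lower s by (cases N) auto

    have "real N powr p \<le> (8192 * s) powr p"
      using N_upper p by (intro powr_mono2) auto
    also have "\<dots> = 8192 powr p * (L / \<mu>)"
      using s sp by (simp add: powr_mult)
    also have "\<dots> \<le> 8192 powr 2 * (L / \<mu>)"
      using p ratio by (intro mult_right_mono powr_mono) auto
    finally have Np_upper: "real N powr p \<le> 8192\<^sup>2 * (L / \<mu>)"
      by simp
    have "\<epsilon>h\<^sup>2 \<le> (1 / 8192 * sqrt (\<mu> / (4 * L)))\<^sup>2"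
      using small \<epsilon>h by (intro power_mono)
    also have "\<dots> = (\<mu> / (4 * L)) / 8192\<^sup>2"
      using L \<mu> by (simp add: power_divide)
    finally have "real N powr p * \<epsilon>h\<^sup>2 \<le> (8192\<^sup>2 * (L / \<mu>)) * ((\<mu> / (4 * L)) / 8192\<^sup>2)"
      using Np_upper L \<mu> by (intro mult_mono) auto
    also have "\<dots> = 1 / 4"
      using L \<mu> by simp
    finally have noise: "real N powr p * \<epsilon>h\<^sup>2 \<le> 1 / 4" .
    have a_eq: "a = 128"
      unfolding a using step_parameter_Max_eq_1 [OF \<epsilon>h, of N p] noise by simp

    have N1: "real N powr 1 \<le> real N powr p"
      using N_pos p by (intro powr_mono) auto
    then have few: "real N * \<epsilon>h\<^sup>2 \<le> 1 / 4"
      using mult_right_mono [OF N1, of "\<epsilon>h\<^sup>2"] noise by simp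
    have "\<epsilon>h\<^sup>2 \<le> real N * \<epsilon>h\<^sup>2"
      using N_pos by (simp add: mult_le_cancel_right1)
    then have "\<epsilon>h\<^sup>2 \<le> (1 / 2)\<^sup>2"
      using few by (simp add: power2_eq_square)
    then have half: "\<epsilon>h \<le> 1 / 2"
      by (rule power2_le_imp_le) simp
    interpret noisy_problem n f g L \<mu> xs G \<epsilon>h
      using \<epsilon>h half noisy by unfold_locales

    have "4096 * s powr p \<le> 4096 powr p * s powr p"
      using p powr_mono [of 1 p "4096::real"] by (intro mult_right_mono) auto
    also have "\<dots> = (4096 * s) powr p"
      using s by (simp add: powr_mult)
    also have "\<dots> \<le> real N powr p"
      using N_lower s p by (intro powr_mono2) auto
    finally have long: "32 * a * L \<le> \<mu> * real N powr p"
      unfolding sp a_eq using \<mu> by (simp add: field_simps)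

    define l where "l = log 2 (\<mu> * R0\<^sup>2 / \<epsilon>)"
    have q_pos: "0 < \<mu> * R0\<^sup>2 / \<epsilon>"
      using \<mu> R0_nz \<epsilon> by simp
    have "log 2 (1 / 2) < l"
      unfolding l_def using \<epsilon> q_pos by (subst log_less_cancel_iff) (auto simp: field_simps)
    then have l_lower: "-1 < l"
      by (simp add: log_divide)
    have K_lower: "l + 1 \<le> real K" and K_upper: "real K < l + 2"
    proof -
      have "real K = real_of_int \<lceil>l + 1\<rceil>"
        unfolding K l_def [symmetric] using l_lower by simp
      then show "l + 1 \<le> real K" "real K < l + 2"
        by linarith+
    qed
    have K_pos: "0 < K"
      using K_lower l_lower by (cases K) auto

    have "\<mu> * R0\<^sup>2 / \<epsilon> = 2 powr l"
      unfolding l_def using q_pos by simp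
    also have "\<dots> \<le> 2 powr real K"
      using K_lower by (intro powr_mono) auto
    finally have budget: "\<mu> * R0\<^sup>2 / \<epsilon> \<le> 2 ^ K"
      by (simp add: powr_realpow)
    have "f (ristm_output G L a p N x0 K) - f xs \<le> \<mu> * R0\<^sup>2 / (4 * 2 ^ K)"
      using ristm_error [OF _ p x0 N_pos few long] K_pos a_eq R0 by simp
    also have "\<dots> \<le> \<epsilon>"
      using budget \<epsilon> by (simp add: field_simps)
    finally have accuracy: "f (ristm_output G L a p N x0 K) - f xs \<le> \<epsilon>" .

    have calls: "real (ristm_calls G L a p N x0 K) = real K * real N"
      by (simp add: ristm_calls_eq)
    have "real_of_int \<lceil>s * l\<rceil> \<le> real K * real N \<and> real K * real N \<le> 24576 * real_of_int \<lceil>s * l\<rceil>"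
      if "\<epsilon> \<le> \<mu> * R0\<^sup>2 / 2"
    proof
      have "log 2 2 \<le> l"
        unfolding l_def using that \<epsilon> q_pos by (subst log_le_cancel_iff) (auto simp: field_simps)
      then have l: "1 \<le> l"
        by simp
      have "real_of_int \<lceil>s * l\<rceil> \<le> s * l + s"
        using s by linarith
      also have "\<dots> = (l + 1) * s"
        by (simp add: algebra_simps)
      also have "\<dots> \<le> real K * real N"
        using K_lower N_lower l s by (intro mult_mono) auto
      finally show "real_of_int \<lceil>s * l\<rceil> \<le> real K * real N" .
      have "real K * real N \<le> (3 * l) * (8192 * s)"
        using K_upper N_upper l s by (intro mult_mono) auto
      also have "\<dots> = 24576 * (s * l)"
        by simp
      also have "\<dots> \<le> 24576 * real_of_int \<lceil>s * l\<rceil>"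
        by simp
      finally show "real K * real N \<le> 24576 * real_of_int \<lceil>s * l\<rceil>" .
    qed
    then show ?thesis
      using accuracy unfolding calls s_def l_def by blast
  qed
  show ?thesis
    by (rule exI [of _ "1 / 8192"], rule exI [of _ 128], rule exI [of _ 4096], rule exI [of _ 24576],
        (rule conjI, simp)+, intro allI impI, rule main)
qed

end
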